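(* Let $R>0$ and let $\Phi$ be real-analytic on $(-R,R)$ with expansion $\Phi(z)=\sum_{n\ge0}c_nz^n$. Let $u,w$ be analytic with radius of convergence $\Lambda$, and let $0<\lambda<\Lambda$. Set $R_0=\max\{\|u\|_\lambda,\|w\|_\lambda\}$ and assume $R_0<R$. Then $$\|\Phi(u)-\Phi(w)\|_\lambda\le\tilde\Phi'(R_0)\,\|u-w\|_\lambda .$$
   Context: A function $f:\mathbb{R}^2\to\mathbb{R}$, $f=f(x,v)$, is analytic with radius of convergence $\Lambda>0$ if it is smooth and there is $C>0$ with $\frac{\Lambda^{k+\ell}}{k!\,\ell!}\|\partial_x^k\partial_v^\ell f\|_\infty\le C$ for all $k,\ell\in\mathbb{N}_0$ ($\|\cdot\|_\infty$ is the supremum norm). For functions of $x$ only (resp. $v$ only) take $\ell=0$ (resp. $k=0$). For $\lambda>0$, $$\|f\|_\lambda=\sum_{k,\ell\ge0}\frac{\lambda^{k+\ell}}{k!\,\ell!}\|\partial_x^k\partial_v^\ell f\|_\infty .$$ $\Phi:\mathbb{R}\to\mathbb{R}$ is real-analytic on $(-R,R)$ if $\Phi(z)=\sum_{n\ge0}c_nz^n$ for all $|z|<R$, with real $c_n$; for $0\le r<R$, $\tilde\Phi'(r)=\sum_{n\ge1}n|c_n|r^{n-1}$. $\Phi(u)=\sum_{n\ge0}c_nu^n$. *)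

theory Defs
  imports "HOL-Analysis.Analysis"
begin

definition dx :: "(real \<times> real \<Rightarrow> real) \<Rightarrow> real \<times> real \<Rightarrow> real" where
  "dx f = (\<lambda>(x, v). deriv (\<lambda>t. f (t, v)) x)"

definition dv :: "(real \<times> real \<Rightarrow> real) \<Rightarrow> real \<times> real \<Rightarrow> real" where
  "dv f = (\<lambda>(x, v). deriv (\<lambda>t. f (x, t)) v)"

text \<open>
  \<open>C_diff n f\<close>: all mixed partial derivatives of order at most \<open>n\<close>, taken in any order,
  exist on the whole plane and are continuous.
\<close>
primrec C_diff :: "nat \<Rightarrow> (real \<times> real \<Rightarrow> real) \<Rightarrow> bool" where
  "C_diff 0 f \<longleftrightarrow> continuous_on UNIV f"
| "C_diff (Suc n) f \<longleftrightarrow>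
     continuous_on UNIV f \<and>
     (\<forall>x v. (\<lambda>t. f (t, v)) differentiable (at x)) \<and>
     (\<forall>x v. (\<lambda>t. f (x, t)) differentiable (at v)) \<and>
     C_diff n (dx f) \<and> C_diff n (dv f)"

definition smooth :: "(real \<times> real \<Rightarrow> real) \<Rightarrow> bool" where
  "smooth f \<longleftrightarrow> (\<forall>n. C_diff n f)"

text \<open>
  The supremum norm and the norm \<open>lam_norm\<close> built from it take values in \<open>[0, \<infinity>]\<close>,
  so an unbounded derivative or a divergent series gives the value \<open>\<infinity>\<close>.
\<close>
definition supnorm :: "(real \<times> real \<Rightarrow> real) \<Rightarrow> ennreal" where
  "supnorm f = (SUP p. ennreal \<bar>f p\<bar>)"

text \<open>
  A function of \<open>x\<close> only is regarded as a function on the plane that does not depend on \<open>v\<close>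
  (and vice versa); all terms with \<open>l > 0\<close> below are then zero.
\<close>
definition analytic_radius :: "real \<Rightarrow> (real \<times> real \<Rightarrow> real) \<Rightarrow> bool" where
  "analytic_radius \<Lambda> f \<longleftrightarrow>
     \<Lambda> > 0 \<and> smooth f \<and>
     (\<exists>C>0. \<forall>k l. ennreal (\<Lambda> ^ (k + l) / (fact k * fact l)) * supnorm ((dx ^^ k) ((dv ^^ l) f))
        \<le> ennreal C)"

definition lam_norm :: "real \<Rightarrow> (real \<times> real \<Rightarrow> real) \<Rightarrow> ennreal" where
  "lam_norm r f =
     (\<Sum>k. \<Sum>l. ennreal (r ^ (k + l) / (fact k * fact l)) * supnorm ((dx ^^ k) ((dv ^^ l) f)))"

definition power_expansion :: "(real \<Rightarrow> real) \<Rightarrow> (nat \<Rightarrow> real) \<Rightarrow> real \<Rightarrow> bool" where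
  "power_expansion \<Phi> c R \<longleftrightarrow> (\<forall>z. \<bar>z\<bar> < R \<longrightarrow> (\<lambda>n. c n * z ^ n) sums \<Phi> z)"

text \<open>
  The series defining \<open>majorant_deriv c r\<close> converges whenever \<open>0 \<le> r < R\<close> and
  \<open>power_expansion \<Phi> c R\<close> holds. The index is shifted by one, so that the sum starts at the
  linear coefficient.
\<close>
definition majorant_deriv :: "(nat \<Rightarrow> real) \<Rightarrow> real \<Rightarrow> real" where
  "majorant_deriv c r = (\<Sum>n. real (Suc n) * \<bar>c (Suc n)\<bar> * r ^ n)"

end

theory Submission
  imports Defs
begin

text \<open>
  On smooth functions \<open>lam_norm\<close> is a submultiplicative seminorm (Leibniz rule and Cauchy
  products), so telescoping \<open>u\<^sup>n - w\<^sup>n\<close> gives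
  \<open>\<parallel>u\<^sup>n - w\<^sup>n\<parallel> \<le> n R\<^sub>0\<^sup>n\<^sup>-\<^sup>1 \<parallel>u - w\<parallel>\<close>, and hence the estimate for every
  truncation of the power series. All partial derivatives of the truncations converge pointwise to
  those of \<open>\<Phi>(u) - \<Phi>(w)\<close>, because differentiating \<open>\<Phi>(u) b\<close> only produces
  terms of the same shape; Fatou's lemma for series then yields the estimate in the limit.
\<close>

section \<open>Smooth functions on the plane\<close>

lemma C_diff_Suc_imp: "C_diff (Suc n) f \<Longrightarrow> C_diff n f"
proof (induction n arbitrary: f)
  case (Suc n)
  have "C_diff n (dx f)" "C_diff n (dv f)"
    using Suc.prems by (auto intro!: Suc.IH simp only: C_diff.simps(2))
  with Suc.prems show ?case
    using C_diff.simps(2)[of n f] C_diff.simps(2)[of "Suc n" f] by blast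
qed simp

lemma smooth_imp_C_diff: "smooth f \<Longrightarrow> C_diff n f"
  by (simp add: smooth_def)

lemma C_diff_continuous: "C_diff n f \<Longrightarrow> continuous_on UNIV f"
  by (cases n) auto

lemma C_diff_has_dx:
  assumes "C_diff (Suc n) f"
  shows "((\<lambda>t. f (t, v)) has_real_derivative dx f (x, v)) (at x)"
  using assms by (simp add: dx_def DERIV_deriv_iff_real_differentiable)

lemma C_diff_has_dv:
  assumes "C_diff (Suc n) f"
  shows "((\<lambda>t. f (x, t)) has_real_derivative dv f (x, v)) (at v)"
  using assms by (simp add: dv_def DERIV_deriv_iff_real_differentiable)

lemma dx_eqI:
  assumes "\<And>x v. ((\<lambda>t. f (t, v)) has_real_derivative f' (x, v)) (at x)"
  shows "dx f = f'"
  by (auto simp: dx_def fun_eq_iff intro!: DERIV_imp_deriv assms)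

lemma dv_eqI:
  assumes "\<And>x v. ((\<lambda>t. f (x, t)) has_real_derivative f' (x, v)) (at v)"
  shows "dv f = f'"
  by (auto simp: dv_def fun_eq_iff intro!: DERIV_imp_deriv assms)

text \<open>Candidate derivatives \<open>fx\<close>, \<open>fv\<close> replace \<open>deriv\<close>:
  uniqueness of derivatives identifies them with \<open>dx f\<close> and \<open>dv f\<close>, so
  inductions on the order can work with explicit formulas.\<close>

lemma C_diff_SucI:
  assumes "continuous_on UNIV f"
    and "\<And>x v. ((\<lambda>t. f (t, v)) has_real_derivative fx (x, v)) (at x)"
    and "\<And>x v. ((\<lambda>t. f (x, t)) has_real_derivative fv (x, v)) (at v)"
    and "C_diff n fx" "C_diff n fv"
  shows "C_diff (Suc n) f"
proof -
  have "dx f = fx" "dv f = fv"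
    by (intro dx_eqI dv_eqI assms)+
  moreover have "(\<lambda>t. f (t, v)) differentiable (at x)" "(\<lambda>t. f (x, t)) differentiable (at v)" for x v
    using assms(2,3) real_differentiable_def by blast+
  ultimately show ?thesis
    using assms(1,4,5) by simp
qed

lemma C_diff_const: "C_diff n (\<lambda>p. a)"
proof (induction n arbitrary: a)
  case (Suc n)
  show ?case by (rule C_diff_SucI[where fx = "\<lambda>p. 0" and fv = "\<lambda>p. 0"]) (auto intro: Suc)
qed auto

lemma C_diff_add: "C_diff n f \<Longrightarrow> C_diff n g \<Longrightarrow> C_diff n (\<lambda>p. f p + g p)"
proof (induction n arbitrary: f g)
  case 0
  then show ?case by (auto intro: continuous_intros)
next
  case (Suc n)
  have "C_diff n (\<lambda>p. dx f p + dx g p)" "C_diff n (\<lambda>p. dv f p + dv g p)"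
    using Suc.prems by (auto intro!: Suc.IH)
  then show ?case
    by (intro C_diff_SucI[where fx = "\<lambda>p. dx f p + dx g p" and fv = "\<lambda>p. dv f p + dv g p"] DERIV_add
        C_diff_has_dx[OF Suc.prems(1)] C_diff_has_dx[OF Suc.prems(2)]
        C_diff_has_dv[OF Suc.prems(1)] C_diff_has_dv[OF Suc.prems(2)])
      (use Suc.prems in \<open>auto intro!: continuous_intros\<close>)
qed

lemma has_derivative_times:
  assumes "(f has_real_derivative a) (at x)" "(g has_real_derivative b) (at x)"
  shows "((\<lambda>t. f t * g t) has_real_derivative a * g x + f x * b) (at x)"
  using DERIV_mult[OF assms] by (simp add: algebra_simps)

lemma C_diff_mult: "C_diff n f \<Longrightarrow> C_diff n g \<Longrightarrow> C_diff n (\<lambda>p. f p * g p)"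
proof (induction n arbitrary: f g)
  case 0
  then show ?case by (auto intro: continuous_intros)
next
  case (Suc n)
  \<comment> \<open>The product rule leaves undifferentiated factors, so their regularity is lowered
    to order \<open>n\<close> to fit the induction hypothesis.\<close>
  have "C_diff n f" "C_diff n g" using Suc.prems C_diff_Suc_imp by blast+
  moreover have "C_diff n (dx f)" "C_diff n (dx g)" "C_diff n (dv f)" "C_diff n (dv g)"
    using Suc.prems by auto
  ultimately have "C_diff n (\<lambda>p. dx f p * g p + f p * dx g p)"
    "C_diff n (\<lambda>p. dv f p * g p + f p * dv g p)"
    by (auto intro!: C_diff_add Suc.IH)
  then show ?case
    by (intro C_diff_SucI[where fx = "\<lambda>p. dx f p * g p + f p * dx g p"
          and fv = "\<lambda>p. dv f p * g p + f p * dv g p"] has_derivative_times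
          C_diff_has_dx[OF Suc.prems(1)] C_diff_has_dx[OF Suc.prems(2)]
          C_diff_has_dv[OF Suc.prems(1)] C_diff_has_dv[OF Suc.prems(2)])
      (use Suc.prems in \<open>auto intro!: continuous_intros\<close>)
qed

lemma smooth_const: "smooth (\<lambda>p. a)"
  by (simp add: smooth_def C_diff_const)

lemma smooth_add: "smooth f \<Longrightarrow> smooth g \<Longrightarrow> smooth (\<lambda>p. f p + g p)"
  by (simp add: smooth_def C_diff_add)

lemma smooth_mult: "smooth f \<Longrightarrow> smooth g \<Longrightarrow> smooth (\<lambda>p. f p * g p)"
  by (simp add: smooth_def C_diff_mult)

lemma smooth_diff: "smooth f \<Longrightarrow> smooth g \<Longrightarrow> smooth (\<lambda>p. f p - g p)"
  using smooth_add[of f "\<lambda>p. - 1 * g p"] smooth_mult[of "\<lambda>p. - 1" g] smooth_const[of "- 1"]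
  by simp

lemma smooth_sum: "(\<And>i. i \<in> I \<Longrightarrow> smooth (f i)) \<Longrightarrow> smooth (\<lambda>p. \<Sum>i\<in>I. f i p)"
  by (induction I rule: infinite_finite_induct) (auto intro: smooth_const smooth_add)

lemma smooth_power: "smooth f \<Longrightarrow> smooth (\<lambda>p. f p ^ n)"
  by (induction n) (auto intro: smooth_const smooth_mult)

lemma smooth_dx: "smooth f \<Longrightarrow> smooth (dx f)"
  unfolding smooth_def by (metis C_diff.simps(2))

lemma smooth_dv: "smooth f \<Longrightarrow> smooth (dv f)"
  unfolding smooth_def by (metis C_diff.simps(2))

lemma smooth_has_dx: "smooth f \<Longrightarrow> ((\<lambda>t. f (t, v)) has_real_derivative dx f (x, v)) (at x)"
  by (rule C_diff_has_dx[OF smooth_imp_C_diff])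

lemma smooth_has_dv: "smooth f \<Longrightarrow> ((\<lambda>t. f (x, t)) has_real_derivative dv f (x, v)) (at v)"
  by (rule C_diff_has_dv[OF smooth_imp_C_diff])

section \<open>Rules common to both partial derivatives\<close>

text \<open>Iterates and the Leibniz rule are derived once and then instantiated for
  \<open>dx\<close> and \<open>dv\<close>. \<open>D_chain\<close> asks for differentiability of the
  outer function only at values of \<open>f\<close>, which suits power series with a finite radius
  of convergence.\<close>

locale partial_derivation =
  fixes D :: "(real \<times> real \<Rightarrow> real) \<Rightarrow> real \<times> real \<Rightarrow> real"
  assumes smooth_D: "smooth f \<Longrightarrow> smooth (D f)"
    and D_add: "smooth f \<Longrightarrow> smooth g \<Longrightarrow> D (\<lambda>p. f p + g p) = (\<lambda>p. D f p + D g p)"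
    and D_mult: "smooth f \<Longrightarrow> smooth g \<Longrightarrow> D (\<lambda>p. f p * g p) = (\<lambda>p. D f p * g p + f p * D g p)"
    and D_chain: "smooth f \<Longrightarrow> (\<And>p. (\<phi> has_real_derivative \<phi>' (f p)) (at (f p)))
      \<Longrightarrow> D (\<lambda>p. \<phi> (f p)) = (\<lambda>p. \<phi>' (f p) * D f p)"
begin

lemma D_const: "D (\<lambda>p. a) = (\<lambda>p. 0)"
  using D_chain[OF smooth_const, of "\<lambda>z. a" "\<lambda>z. 0" 0] by simp

lemma smooth_D_funpow: "smooth f \<Longrightarrow> smooth ((D ^^ k) f)"
  by (induction k) (auto intro: smooth_D)

lemma D_cmult: "smooth f \<Longrightarrow> D (\<lambda>p. a * f p) = (\<lambda>p. a * D f p)"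
  by (simp add: D_mult D_const smooth_const)

lemma D_sum:
  "(\<And>i. i \<in> I \<Longrightarrow> smooth (f i)) \<Longrightarrow> D (\<lambda>p. \<Sum>i\<in>I. f i p) = (\<lambda>p. \<Sum>i\<in>I. D (f i) p)"
  by (induction I rule: infinite_finite_induct) (auto simp: D_const D_add smooth_sum)

lemma D_funpow_add:
  "smooth f \<Longrightarrow> smooth g \<Longrightarrow> (D ^^ k) (\<lambda>p. f p + g p) = (\<lambda>p. (D ^^ k) f p + (D ^^ k) g p)"
  by (induction k) (auto simp: D_add smooth_D_funpow)

lemma D_funpow_cmult: "smooth f \<Longrightarrow> (D ^^ k) (\<lambda>p. a * f p) = (\<lambda>p. a * (D ^^ k) f p)"
  by (induction k) (auto simp: D_cmult smooth_D_funpow)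

lemma D_funpow_sum:
  "(\<And>i. i \<in> I \<Longrightarrow> smooth (f i)) \<Longrightarrow>
     (D ^^ k) (\<lambda>p. \<Sum>i\<in>I. f i p) = (\<lambda>p. \<Sum>i\<in>I. (D ^^ k) (f i) p)"
  by (induction k) (auto simp: D_sum smooth_D_funpow)

lemma D_funpow_const: "(D ^^ k) (\<lambda>p. a) = (\<lambda>p. if k = 0 then a else 0)"
  by (induction k) (auto simp: D_const)

end

interpretation dx: partial_derivation dx
proof
  fix f g :: "real \<times> real \<Rightarrow> real" and \<phi> \<phi>' :: "real \<Rightarrow> real"
  assume f: "smooth f"
  show "smooth (dx f)" using f by (rule smooth_dx)
  show "dx (\<lambda>p. \<phi> (f p)) = (\<lambda>p. \<phi>' (f p) * dx f p)"
    if "\<And>p. (\<phi> has_real_derivative \<phi>' (f p)) (at (f p))"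
    by (rule dx_eqI, rule DERIV_chain2[OF that smooth_has_dx[OF f]])
  assume g: "smooth g"
  show "dx (\<lambda>p. f p + g p) = (\<lambda>p. dx f p + dx g p)"
    by (rule dx_eqI) (intro DERIV_add smooth_has_dx f g)
  show "dx (\<lambda>p. f p * g p) = (\<lambda>p. dx f p * g p + f p * dx g p)"
    by (rule dx_eqI) (intro has_derivative_times smooth_has_dx f g)
qed

interpretation dv: partial_derivation dv
proof
  fix f g :: "real \<times> real \<Rightarrow> real" and \<phi> \<phi>' :: "real \<Rightarrow> real"
  assume f: "smooth f"
  show "smooth (dv f)" using f by (rule smooth_dv)
  show "dv (\<lambda>p. \<phi> (f p)) = (\<lambda>p. \<phi>' (f p) * dv f p)"
    if "\<And>p. (\<phi> has_real_derivative \<phi>' (f p)) (at (f p))"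
    by (rule dv_eqI, rule DERIV_chain2[OF that smooth_has_dv[OF f]])
  assume g: "smooth g"
  show "dv (\<lambda>p. f p + g p) = (\<lambda>p. dv f p + dv g p)"
    by (rule dv_eqI) (intro DERIV_add smooth_has_dv f g)
  show "dv (\<lambda>p. f p * g p) = (\<lambda>p. dv f p * g p + f p * dv g p)"
    by (rule dv_eqI) (intro has_derivative_times smooth_has_dv f g)
qed

text \<open>Combinatorial core of the Leibniz rule: shift the index in the second half of the sum,
  then combine coefficients by Pascal's identity.\<close>

lemma sum_binomial_Suc_shift:
  fixes a b :: "nat \<Rightarrow> 'a :: comm_semiring_1"
  shows "(\<Sum>i\<le>k. of_nat (k choose i) * (a (Suc i) * b (k - i) + a i * b (Suc (k - i)))) =
    (\<Sum>i\<le>Suc k. of_nat (Suc k choose i) * (a i * b (Suc k - i)))"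
proof -
  have 1: "(\<Sum>i\<le>k. of_nat (k choose i) * (a i * b (Suc (k - i)))) =
      a 0 * b (Suc k) + (\<Sum>i\<le>k. of_nat (k choose Suc i) * (a (Suc i) * b (k - i)))"
  proof -
    have "(\<Sum>i\<le>k. of_nat (k choose i) * (a i * b (Suc (k - i)))) =
      (\<Sum>i\<le>Suc k. of_nat (k choose i) * (a i * b (Suc k - i)))"
      \<comment> \<open>The added term \<open>i = Suc k\<close> vanishes because
        \<open>k choose Suc k\<close> is zero.\<close>
      by (auto simp: Suc_diff_le binomial_eq_0 intro!: sum.cong)
    also have "\<dots> = a 0 * b (Suc k) + (\<Sum>i\<le>k. of_nat (k choose Suc i) * (a (Suc i) * b (k - i)))"
      by (subst sum.atMost_Suc_shift) simp
    finally show ?thesis .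
  qed
  show ?thesis
    by (subst sum.atMost_Suc_shift)
      (simp add: distrib_left distrib_right sum.distrib 1 add_ac del: sum.atMost_Suc)
qed

lemma (in partial_derivation) D_funpow_mult:
  assumes "smooth f" "smooth g"
  shows "(D ^^ k) (\<lambda>p. f p * g p) =
    (\<lambda>p. \<Sum>i\<le>k. real (k choose i) * ((D ^^ i) f p * (D ^^ (k - i)) g p))"
proof (induction k)
  case (Suc k)
  note s = smooth_D_funpow[OF assms(1)] smooth_D_funpow[OF assms(2)]
  have "(D ^^ Suc k) (\<lambda>p. f p * g p) =
      D (\<lambda>p. \<Sum>i\<le>k. real (k choose i) * ((D ^^ i) f p * (D ^^ (k - i)) g p))"
    by (simp add: Suc)
  also have "\<dots> = (\<lambda>p. \<Sum>i\<le>k. D (\<lambda>p. real (k choose i) * ((D ^^ i) f p * (D ^^ (k - i)) g p)) p)"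
    by (intro D_sum smooth_mult smooth_const s)
  also have "\<dots> = (\<lambda>p. \<Sum>i\<le>k. real (k choose i) * ((D ^^ Suc i) f p * (D ^^ (k - i)) g p
        + (D ^^ i) f p * (D ^^ Suc (k - i)) g p))"
    by (simp add: D_cmult[OF smooth_mult[OF s]] D_mult[OF s])
  also have "\<dots> = (\<lambda>p. \<Sum>i\<le>Suc k. real (Suc k choose i) * ((D ^^ i) f p * (D ^^ (Suc k - i)) g p))"
    using sum_binomial_Suc_shift[of k "\<lambda>i. (D ^^ i) f p" "\<lambda>i. (D ^^ i) g p" for p]
    by (simp only:)
  finally show ?case .
qed simp

lemma mixed_add:
  "smooth f \<Longrightarrow> smooth g \<Longrightarrow> (dx ^^ k) ((dv ^^ l) (\<lambda>p. f p + g p)) =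
     (\<lambda>p. (dx ^^ k) ((dv ^^ l) f) p + (dx ^^ k) ((dv ^^ l) g) p)"
  by (simp only: dv.D_funpow_add dx.D_funpow_add dv.smooth_D_funpow)

lemma mixed_cmult:
  "smooth f \<Longrightarrow> (dx ^^ k) ((dv ^^ l) (\<lambda>p. a * f p)) = (\<lambda>p. a * (dx ^^ k) ((dv ^^ l) f) p)"
  by (simp only: dv.D_funpow_cmult dx.D_funpow_cmult dv.smooth_D_funpow)

lemma mixed_diff:
  "smooth f \<Longrightarrow> smooth g \<Longrightarrow> (dx ^^ k) ((dv ^^ l) (\<lambda>p. f p - g p)) =
     (\<lambda>p. (dx ^^ k) ((dv ^^ l) f) p - (dx ^^ k) ((dv ^^ l) g) p)"
  using mixed_add[of f "\<lambda>p. - 1 * g p"] mixed_cmult[of g k l "- 1"]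
    smooth_mult[of "\<lambda>p. - 1" g] smooth_const[of "- 1"]
  by simp

text \<open>The Leibniz rule in \<open>v\<close> comes first; the rule in \<open>x\<close> is then
  applied to each summand.\<close>

lemma mixed_mult:
  assumes "smooth f" "smooth g"
  shows "(dx ^^ k) ((dv ^^ l) (\<lambda>p. f p * g p)) =
    (\<lambda>p. \<Sum>j\<le>l. \<Sum>i\<le>k. real (l choose j) * real (k choose i) *
       ((dx ^^ i) ((dv ^^ j) f) p * (dx ^^ (k - i)) ((dv ^^ (l - j)) g) p))"
proof -
  note s = dv.smooth_D_funpow[OF assms(1)] dv.smooth_D_funpow[OF assms(2)]
  have "(dx ^^ k) ((dv ^^ l) (\<lambda>p. f p * g p)) =
      (\<lambda>p. \<Sum>j\<le>l. (dx ^^ k) (\<lambda>p. real (l choose j) * ((dv ^^ j) f p * (dv ^^ (l - j)) g p)) p)"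
    unfolding dv.D_funpow_mult[OF assms]
    by (intro dx.D_funpow_sum smooth_mult smooth_const s)
  then show ?thesis
    by (simp only: dx.D_funpow_cmult[OF smooth_mult[OF s]] dx.D_funpow_mult[OF s]
        sum_distrib_left mult.assoc)
qed

section \<open>The norm\<close>

lemma supnorm_upper: "ennreal \<bar>f p\<bar> \<le> supnorm f"
  unfolding supnorm_def by (rule SUP_upper) simp

lemma supnorm_least: "(\<And>p. ennreal \<bar>f p\<bar> \<le> b) \<Longrightarrow> supnorm f \<le> b"
  unfolding supnorm_def by (rule SUP_least)

lemma supnorm_const: "supnorm (\<lambda>p. a) = ennreal \<bar>a\<bar>"
  by (simp add: supnorm_def)

lemma supnorm_add: "supnorm (\<lambda>p. f p + g p) \<le> supnorm f + supnorm g"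
proof (rule supnorm_least)
  fix p
  have "ennreal \<bar>f p + g p\<bar> \<le> ennreal \<bar>f p\<bar> + ennreal \<bar>g p\<bar>"
    by (simp add: abs_triangle_ineq ennreal_leI flip: ennreal_plus)
  also have "\<dots> \<le> supnorm f + supnorm g"
    by (intro add_mono supnorm_upper)
  finally show "ennreal \<bar>f p + g p\<bar> \<le> supnorm f + supnorm g" .
qed

lemma supnorm_sum: "supnorm (\<lambda>p. \<Sum>i\<in>I. f i p) \<le> (\<Sum>i\<in>I. supnorm (f i))"
proof (induction I rule: infinite_finite_induct)
  case (insert i I)
  have "supnorm (\<lambda>p. f i p + (\<Sum>i\<in>I. f i p)) \<le> supnorm (f i) + supnorm (\<lambda>p. \<Sum>i\<in>I. f i p)"
    by (rule supnorm_add)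
  also have "\<dots> \<le> supnorm (f i) + (\<Sum>i\<in>I. supnorm (f i))"
    by (rule add_left_mono[OF insert.IH])
  finally show ?case using insert.hyps by simp
qed (auto simp: supnorm_const)

lemma supnorm_mult: "supnorm (\<lambda>p. f p * g p) \<le> supnorm f * supnorm g"
  by (rule supnorm_least) (auto simp: abs_mult ennreal_mult intro!: mult_mono supnorm_upper)

lemma supnorm_cmult: "supnorm (\<lambda>p. a * f p) \<le> ennreal \<bar>a\<bar> * supnorm f"
  using supnorm_mult[of "\<lambda>p. a" f] by (simp add: supnorm_const)

section \<open>The weighted norm as a submultiplicative seminorm\<close>

definition lam_term :: "real \<Rightarrow> (real \<times> real \<Rightarrow> real) \<Rightarrow> nat \<Rightarrow> nat \<Rightarrow> ennreal" where
  "lam_term r f k l =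
     ennreal (r ^ (k + l) / (fact k * fact l)) * supnorm ((dx ^^ k) ((dv ^^ l) f))"

lemma lam_norm_eq: "lam_norm r f = (\<Sum>k. \<Sum>l. lam_term r f k l)"
  by (simp add: lam_norm_def lam_term_def)

lemma suminf_double_mono:
  fixes f g :: "nat \<Rightarrow> nat \<Rightarrow> ennreal"
  shows "(\<And>k l. f k l \<le> g k l) \<Longrightarrow> (\<Sum>k. \<Sum>l. f k l) \<le> (\<Sum>k. \<Sum>l. g k l)"
  by (intro suminf_le summableI)

lemma lam_norm_add:
  assumes "smooth f" "smooth g"
  shows "lam_norm r (\<lambda>p. f p + g p) \<le> lam_norm r f + lam_norm r g"
proof -
  have "lam_term r (\<lambda>p. f p + g p) k l \<le> lam_term r f k l + lam_term r g k l" for k l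
    unfolding lam_term_def mixed_add[OF assms] distrib_left[symmetric]
    by (intro mult_left_mono supnorm_add) simp
  then have "lam_norm r (\<lambda>p. f p + g p) \<le> (\<Sum>k. \<Sum>l. lam_term r f k l + lam_term r g k l)"
    unfolding lam_norm_eq by (rule suminf_double_mono)
  also have "\<dots> = lam_norm r f + lam_norm r g"
    by (simp add: lam_norm_eq suminf_add[symmetric] summableI)
  finally show ?thesis .
qed

lemma lam_norm_cmult:
  assumes "smooth f"
  shows "lam_norm r (\<lambda>p. a * f p) \<le> ennreal \<bar>a\<bar> * lam_norm r f"
proof -
  have "lam_term r (\<lambda>p. a * f p) k l \<le> ennreal \<bar>a\<bar> * lam_term r f k l" for k l
    unfolding lam_term_def mixed_cmult[OF assms] mult.left_commute[of "ennreal \<bar>a\<bar>"]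
    by (intro mult_left_mono supnorm_cmult) simp
  then have "lam_norm r (\<lambda>p. a * f p) \<le> (\<Sum>k. \<Sum>l. ennreal \<bar>a\<bar> * lam_term r f k l)"
    unfolding lam_norm_eq by (rule suminf_double_mono)
  also have "\<dots> = ennreal \<bar>a\<bar> * lam_norm r f"
    by (simp add: lam_norm_eq)
  finally show ?thesis .
qed

lemma lam_norm_const: "lam_norm r (\<lambda>p. a) = ennreal \<bar>a\<bar>"
proof -
  \<comment> \<open>Nesting the conditionals with \<open>l\<close> outermost lets the inner sum
    collapse first.\<close>
  have "lam_term r (\<lambda>p. a) k l = (if l = 0 then if k = 0 then ennreal \<bar>a\<bar> else 0 else 0)" for k l
    by (auto simp: lam_term_def dx.D_funpow_const dv.D_funpow_const supnorm_const)
  then have "lam_norm r (\<lambda>p. a) = (\<Sum>k. \<Sum>l. if l = 0 then if k = 0 then ennreal \<bar>a\<bar> else 0 else 0)"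
    by (simp add: lam_norm_eq)
  also have "\<dots> = (\<Sum>k. if k = 0 then ennreal \<bar>a\<bar> else 0)"
    by (subst suminf_finite[of "{0}"]) auto
  also have "\<dots> = ennreal \<bar>a\<bar>"
    by (subst suminf_finite[of "{0}"]) auto
  finally show ?thesis .
qed

lemma lam_norm_sum:
  assumes "\<And>i. i \<in> I \<Longrightarrow> smooth (f i)"
  shows "lam_norm r (\<lambda>p. \<Sum>i\<in>I. f i p) \<le> (\<Sum>i\<in>I. lam_norm r (f i))"
  using assms
proof (induction I rule: infinite_finite_induct)
  case (insert i I)
  have "lam_norm r (\<lambda>p. f i p + (\<Sum>i\<in>I. f i p)) \<le> lam_norm r (f i) + lam_norm r (\<lambda>p. \<Sum>i\<in>I. f i p)"
    using insert.prems by (intro lam_norm_add smooth_sum) auto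
  also have "\<dots> \<le> lam_norm r (f i) + (\<Sum>i\<in>I. lam_norm r (f i))"
    using insert by (intro add_left_mono insert.IH) auto
  finally show ?case using insert.hyps by simp
qed (auto simp: lam_norm_const)

text \<open>The term \<open>k = l = 0\<close> has weight 1. This bound is what keeps the values of
  \<open>u\<close> and \<open>w\<close> inside the interval of convergence.\<close>

lemma supnorm_le_lam_norm: "supnorm f \<le> lam_norm r f"
proof -
  have "supnorm f = lam_term r f 0 0" by (simp add: lam_term_def)
  also have "\<dots> \<le> (\<Sum>l. lam_term r f 0 l)"
    using sum_le_suminf[OF summableI, of "{0}" "\<lambda>l. lam_term r f 0 l"] by simp
  also have "\<dots> \<le> (\<Sum>k. \<Sum>l. lam_term r f k l)"
    using sum_le_suminf[OF summableI, of "{0}" "\<lambda>k. \<Sum>l. lam_term r f k l"] by simp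
  finally show ?thesis by (simp add: lam_norm_eq)
qed

text \<open>The triangle \<open>i + j < n\<close> lies in the square of side \<open>n\<close> and
  all terms are nonnegative, so each partial sum is bounded, even when the series diverge.\<close>

lemma suminf_Cauchy_product_le:
  fixes f g :: "nat \<Rightarrow> ennreal"
  shows "(\<Sum>k. \<Sum>i\<le>k. f i * g (k - i)) \<le> (\<Sum>k. f k) * (\<Sum>k. g k)"
proof (rule suminf_le_const[OF summableI])
  fix n
  have "(\<Sum>k<n. \<Sum>i\<le>k. f i * g (k - i)) = (\<Sum>(i, j)\<in>{(i, j). i + j < n}. f i * g j)"
    by (rule sum.triangle_reindex[symmetric])
  also have "\<dots> \<le> (\<Sum>(i, j)\<in>{..<n} \<times> {..<n}. f i * g j)"
    by (rule sum_mono2) auto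
  also have "\<dots> = (\<Sum>i<n. f i) * (\<Sum>j<n. g j)"
    by (simp add: sum_product sum.cartesian_product)
  also have "\<dots> \<le> (\<Sum>k. f k) * (\<Sum>k. g k)"
    by (intro mult_mono sum_le_suminf summableI) auto
  finally show "(\<Sum>k<n. \<Sum>i\<le>k. f i * g (k - i)) \<le> (\<Sum>k. f k) * (\<Sum>k. g k)" .
qed

text \<open>The weights absorb the binomial coefficients of the Leibniz rule:
  \<open>k choose i\<close> divided by \<open>fact k\<close> is the reciprocal of
  \<open>fact i * fact (k - i)\<close>. What remains is a plain two-dimensional Cauchy
  product.\<close>

lemma lam_term_mult:
  assumes "smooth f" "smooth g" "r \<ge> 0"
  shows "lam_term r (\<lambda>p. f p * g p) k l \<le>
    (\<Sum>i\<le>k. \<Sum>j\<le>l. lam_term r f i j * lam_term r g (k - i) (l - j))"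
proof -
  let ?c = "\<lambda>k l. r ^ (k + l) / (fact k * fact l)"
  let ?S = "\<lambda>f k l. supnorm ((dx ^^ k) ((dv ^^ l) f))"
  have c: "?c k l * (real (l choose j) * real (k choose i)) = ?c i j * ?c (k - i) (l - j)"
    if "i \<le> k" "j \<le> l" for i j
  proof -
    have "r ^ (k + l) = r ^ (i + j) * r ^ ((k - i) + (l - j))"
      using that by (simp add: power_add[symmetric])
    then show ?thesis
      using that by (simp add: binomial_fact field_simps)
  qed
  have "lam_term r (\<lambda>p. f p * g p) k l \<le> ennreal (?c k l) *
      (\<Sum>j\<le>l. \<Sum>i\<le>k. ennreal (real (l choose j) * real (k choose i)) * (?S f i j * ?S g (k - i) (l - j)))"
    unfolding lam_term_def mixed_mult[OF assms(1,2)]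
  proof (intro mult_left_mono order.trans[OF supnorm_sum] sum_mono)
    fix i j
    show "supnorm (\<lambda>p. real (l choose j) * real (k choose i) *
        ((dx ^^ i) ((dv ^^ j) f) p * (dx ^^ (k - i)) ((dv ^^ (l - j)) g) p))
      \<le> ennreal (real (l choose j) * real (k choose i)) * (?S f i j * ?S g (k - i) (l - j))"
      by (rule order.trans[OF supnorm_cmult]) (auto intro!: mult_left_mono supnorm_mult)
  qed simp
  also have "\<dots> = (\<Sum>j\<le>l. \<Sum>i\<le>k. ennreal (?c k l * (real (l choose j) * real (k choose i)))
      * (?S f i j * ?S g (k - i) (l - j)))"
    using \<open>r \<ge> 0\<close> by (subst ennreal_mult) (auto simp: sum_distrib_left mult.assoc)
  also have "\<dots> = (\<Sum>j\<le>l. \<Sum>i\<le>k. lam_term r f i j * lam_term r g (k - i) (l - j))"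
  proof (intro sum.cong refl)
    fix i j assume "i \<in> {..k}" "j \<in> {..l}"
    then have "?c k l * (real (l choose j) * real (k choose i)) = ?c i j * ?c (k - i) (l - j)"
      by (intro c) auto
    moreover have "ennreal (?c i j * ?c (k - i) (l - j)) =
        ennreal (?c i j) * ennreal (?c (k - i) (l - j))"
      using \<open>r \<ge> 0\<close> by (intro ennreal_mult) auto
    ultimately show "ennreal (?c k l * (real (l choose j) * real (k choose i)))
      * (?S f i j * ?S g (k - i) (l - j)) = lam_term r f i j * lam_term r g (k - i) (l - j)"
      by (simp add: lam_term_def mult_ac)
  qed
  also have "\<dots> = (\<Sum>i\<le>k. \<Sum>j\<le>l. lam_term r f i j * lam_term r g (k - i) (l - j))"
    by (rule sum.swap)
  finally show ?thesis .
qed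

text \<open>The Cauchy product bound is applied twice: in the \<open>v\<close>-order for fixed
  \<open>k\<close> and \<open>i\<close>, then in the \<open>x\<close>-order.\<close>

lemma lam_norm_mult:
  assumes "smooth f" "smooth g" "r \<ge> 0"
  shows "lam_norm r (\<lambda>p. f p * g p) \<le> lam_norm r f * lam_norm r g"
proof -
  let ?f = "lam_term r f" and ?g = "lam_term r g"
  have "lam_norm r (\<lambda>p. f p * g p) \<le> (\<Sum>k. \<Sum>l. \<Sum>i\<le>k. \<Sum>j\<le>l. ?f i j * ?g (k - i) (l - j))"
    unfolding lam_norm_eq by (rule suminf_double_mono) (rule lam_term_mult[OF assms])
  also have "\<dots> = (\<Sum>k. \<Sum>i\<le>k. \<Sum>l. \<Sum>j\<le>l. ?f i j * ?g (k - i) (l - j))"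
    by (simp add: suminf_sum summableI)
  also have "\<dots> \<le> (\<Sum>k. \<Sum>i\<le>k. (\<Sum>j. ?f i j) * (\<Sum>j. ?g (k - i) j))"
    by (intro suminf_le summableI sum_mono suminf_Cauchy_product_le)
  also have "\<dots> \<le> lam_norm r f * lam_norm r g"
    unfolding lam_norm_eq by (rule suminf_Cauchy_product_le)
  finally show ?thesis .
qed

lemma lam_norm_power:
  assumes "smooth f" "r \<ge> 0"
  shows "lam_norm r (\<lambda>p. f p ^ n) \<le> lam_norm r f ^ n"
proof (induction n)
  case (Suc n)
  have "lam_norm r (\<lambda>p. f p * f p ^ n) \<le> lam_norm r f * lam_norm r (\<lambda>p. f p ^ n)"
    by (intro lam_norm_mult smooth_power assms)
  also have "\<dots> \<le> lam_norm r f * lam_norm r f ^ n"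
    by (intro mult_left_mono Suc) simp
  finally show ?case by simp
qed (simp add: lam_norm_const)

text \<open>Induction along \<open>u^(n+1) - w^(n+1) = u (u^n - w^n) + (u - w) w^n\<close>. Stating
  it for \<open>Suc n\<close> keeps natural subtraction out of the exponent of
  \<open>M\<close>.\<close>

lemma lam_norm_power_diff:
  assumes "smooth u" "smooth w" "r \<ge> 0" "lam_norm r u \<le> M" "lam_norm r w \<le> M"
  shows "lam_norm r (\<lambda>p. u p ^ Suc n - w p ^ Suc n) \<le>
    of_nat (Suc n) * M ^ n * lam_norm r (\<lambda>p. u p - w p)"
proof (induction n)
  case (Suc n)
  let ?d = "lam_norm r (\<lambda>p. u p - w p)"
  have "lam_norm r (\<lambda>p. u p ^ Suc (Suc n) - w p ^ Suc (Suc n)) =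
      lam_norm r (\<lambda>p. u p * (u p ^ Suc n - w p ^ Suc n) + (u p - w p) * w p ^ Suc n)"
    by (simp add: algebra_simps)
  also have "\<dots> \<le> lam_norm r (\<lambda>p. u p * (u p ^ Suc n - w p ^ Suc n))
      + lam_norm r (\<lambda>p. (u p - w p) * w p ^ Suc n)"
    by (intro lam_norm_add smooth_mult smooth_diff smooth_power assms)
  also have "\<dots> \<le> lam_norm r u * lam_norm r (\<lambda>p. u p ^ Suc n - w p ^ Suc n)
      + ?d * lam_norm r (\<lambda>p. w p ^ Suc n)"
    by (intro add_mono lam_norm_mult smooth_diff smooth_power assms)
  also have "\<dots> \<le> M * (of_nat (Suc n) * M ^ n * ?d) + ?d * M ^ Suc n"
    by (intro add_mono mult_mono Suc assms order.trans[OF lam_norm_power] power_mono) auto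
  also have "\<dots> = of_nat (Suc (Suc n)) * M ^ Suc n * ?d"
    by (simp add: algebra_simps)
  finally show ?case .
qed simp

section \<open>Passage to the limit in the norm\<close>

text \<open>Fatou's lemma for counting measure on the naturals.\<close>

lemma suminf_liminf_le:
  fixes f :: "nat \<Rightarrow> nat \<Rightarrow> ennreal"
  shows "(\<Sum>k. liminf (\<lambda>N. f N k)) \<le> liminf (\<lambda>N. \<Sum>k. f N k)"
  using nn_integral_liminf[of f "count_space UNIV"] by (simp add: nn_integral_count_space_nat)

text \<open>Lower semicontinuity of the norm: each weighted derivative obeys a liminf bound at every
  point, and Fatou carries these bounds through both sums.\<close>

lemma lam_norm_limit_le:
  assumes lim: "\<And>k l p. (\<lambda>N. (dx ^^ k) ((dv ^^ l) (f N)) p) \<longlonglongrightarrow> (dx ^^ k) ((dv ^^ l) g) p"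
    and le: "\<And>N. lam_norm r (f N) \<le> M"
  shows "lam_norm r g \<le> M"
proof -
  have "lam_term r g k l \<le> liminf (\<lambda>N. lam_term r (f N) k l)" for k l
  proof -
    let ?c = "ennreal (r ^ (k + l) / (fact k * fact l))"
    \<comment> \<open>The point \<open>p\<close> is fixed here; the right-hand side does not depend
      on it, so the supremum can be taken afterwards.\<close>
    have "?c * ennreal \<bar>(dx ^^ k) ((dv ^^ l) g) p\<bar> \<le> liminf (\<lambda>N. lam_term r (f N) k l)" for p
    proof -
      have "(\<lambda>N. ?c * ennreal \<bar>(dx ^^ k) ((dv ^^ l) (f N)) p\<bar>)
          \<longlonglongrightarrow> ?c * ennreal \<bar>(dx ^^ k) ((dv ^^ l) g) p\<bar>"
        by (intro ennreal_tendsto_cmult tendsto_ennrealI tendsto_rabs lim) simp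
      then have "?c * ennreal \<bar>(dx ^^ k) ((dv ^^ l) g) p\<bar> =
          liminf (\<lambda>N. ?c * ennreal \<bar>(dx ^^ k) ((dv ^^ l) (f N)) p\<bar>)"
        by (intro lim_imp_Liminf[symmetric]) auto
      also have "\<dots> \<le> liminf (\<lambda>N. lam_term r (f N) k l)"
        unfolding lam_term_def
        by (intro Liminf_mono always_eventually allI mult_left_mono supnorm_upper) simp
      finally show ?thesis .
    qed
    then show ?thesis
      unfolding lam_term_def[of r g] supnorm_def SUP_mult_left_ennreal by (rule SUP_least)
  qed
  then have "lam_norm r g \<le> (\<Sum>k. \<Sum>l. liminf (\<lambda>N. lam_term r (f N) k l))"
    unfolding lam_norm_eq by (rule suminf_double_mono)
  \<comment> \<open>Fatou for the inner sum, and in the next step for the outer one.\<close>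
  also have "\<dots> \<le> (\<Sum>k. liminf (\<lambda>N. \<Sum>l. lam_term r (f N) k l))"
    by (intro suminf_le summableI suminf_liminf_le)
  also have "\<dots> \<le> liminf (\<lambda>N. lam_norm r (f N))"
    unfolding lam_norm_eq by (rule suminf_liminf_le)
  also have "\<dots> \<le> liminf (\<lambda>N. M)"
    by (intro Liminf_mono always_eventually allI le)
  finally show ?thesis by (simp add: Liminf_const)
qed

section \<open>Composition with power series\<close>

text \<open>Mentions only the coefficients and no sum function, so that it passes directly to
  \<open>diffs c\<close> and to truncations.\<close>

definition converges_within :: "real \<Rightarrow> (nat \<Rightarrow> real) \<Rightarrow> bool" where
  "converges_within R c \<longleftrightarrow> (\<forall>z. \<bar>z\<bar> < R \<longrightarrow> summable (\<lambda>n. c n * z ^ n))"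

definition powser :: "(nat \<Rightarrow> real) \<Rightarrow> real \<Rightarrow> real" where
  "powser c z = (\<Sum>n. c n * z ^ n)"

text \<open>Padding with zeros makes a partial sum another \<open>powser\<close>, so smoothness and
  derivative rules cover polynomials and full series alike.\<close>

definition trunc :: "nat \<Rightarrow> (nat \<Rightarrow> real) \<Rightarrow> nat \<Rightarrow> real" where
  "trunc N c n = (if n < N then c n else 0)"

lemma converges_within_diffs: "converges_within R c \<Longrightarrow> converges_within R (diffs c)"
  unfolding converges_within_def using termdiff_converges[of _ R c] by auto

lemma powser_has_derivative:
  "converges_within R c \<Longrightarrow> \<bar>z\<bar> < R \<Longrightarrow> (powser c has_real_derivative powser (diffs c) z) (at z)"
  unfolding converges_within_def powser_def[abs_def]
  using termdiffs_strong'[of R c z] by auto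

lemma converges_within_trunc: "converges_within R (trunc N c)"
  unfolding converges_within_def
  by (auto simp: trunc_def split: if_splits intro!: summable_finite[of "{..<N}"])

lemma powser_trunc: "powser (trunc N c) z = (\<Sum>n<N. c n * z ^ n)"
  unfolding powser_def by (subst suminf_finite[of "{..<N}"]) (auto simp: trunc_def)

text \<open>Differentiation lowers the truncation order by one, which explains the index shifts in
  \<open>trunc_limit_step\<close>.\<close>

lemma diffs_trunc: "diffs (trunc (Suc N) c) = trunc N (diffs c)"
  by (auto simp: diffs_def trunc_def)

lemma powser_trunc_tendsto:
  "converges_within R c \<Longrightarrow> \<bar>z\<bar> < R \<Longrightarrow> (\<lambda>N. powser (trunc N c) z) \<longlonglongrightarrow> powser c z"
  unfolding powser_trunc unfolding powser_def converges_within_def by (blast intro: summable_LIMSEQ)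

text \<open>The induction must generalise over \<open>c\<close>, since the chain rule replaces
  \<open>c\<close> by \<open>diffs c\<close>.\<close>

lemma C_diff_powser:
  assumes "smooth u" "\<And>p. \<bar>u p\<bar> < R"
  shows "converges_within R c \<Longrightarrow> C_diff n (\<lambda>p. powser c (u p))"
proof (induction n arbitrary: c)
  case 0
  have "isCont (powser c) (u p)" for p
    using powser_has_derivative[OF 0 assms(2)] by (rule DERIV_isCont)
  then have "continuous_on UNIV (\<lambda>p. powser c (u p))"
    using C_diff_continuous[OF smooth_imp_C_diff[OF assms(1)]]
    by (auto simp: continuous_on_eq_continuous_at intro: isCont_o2)
  then show ?case by simp
next
  case (Suc n)
  note d = powser_has_derivative[OF Suc.prems assms(2)]
  have "C_diff n (\<lambda>p. powser c (u p))" by (intro Suc)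
  moreover have "C_diff n (\<lambda>p. powser (diffs c) (u p) * dx u p)"
    "C_diff n (\<lambda>p. powser (diffs c) (u p) * dv u p)"
    by (intro C_diff_mult Suc.IH converges_within_diffs Suc.prems smooth_imp_C_diff
        smooth_dx smooth_dv assms)+
  ultimately show ?case
    by (intro C_diff_SucI[where fx = "\<lambda>p. powser (diffs c) (u p) * dx u p"
          and fv = "\<lambda>p. powser (diffs c) (u p) * dv u p"]
        DERIV_chain2[OF d smooth_has_dx[OF assms(1)]]
        DERIV_chain2[OF d smooth_has_dv[OF assms(1)]] C_diff_continuous)
qed

lemma smooth_powser:
  "smooth u \<Longrightarrow> (\<And>p. \<bar>u p\<bar> < R) \<Longrightarrow> converges_within R c \<Longrightarrow> smooth (\<lambda>p. powser c (u p))"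
  unfolding smooth_def[of "\<lambda>p. powser c (u p)"] by (blast intro: C_diff_powser)

text \<open>Both resulting terms are again a power series in \<open>u\<close> times a smooth factor;
  this closure drives the induction on the order of differentiation.\<close>

lemma (in partial_derivation) D_powser_mult:
  assumes "smooth u" "\<And>p. \<bar>u p\<bar> < R" "converges_within R c" "smooth b"
  shows "D (\<lambda>p. powser c (u p) * b p) =
    (\<lambda>p. powser (diffs c) (u p) * (D u p * b p) + powser c (u p) * D b p)"
  using D_mult[OF smooth_powser[OF assms(1-3)] assms(4)]
    D_chain[OF assms(1) powser_has_derivative[OF assms(3,2)]]
  by (simp add: mult.assoc)

text \<open>
  The additional factor \<open>b\<close> makes the convergence statement stable under inserting one more
  derivative below \<open>T\<close>.
\<close>
definition trunc_limit ::
  "(real \<times> real \<Rightarrow> real) \<Rightarrow> real \<Rightarrow> ((real \<times> real \<Rightarrow> real) \<Rightarrow> real \<times> real \<Rightarrow> real) \<Rightarrow> bool" where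
  "trunc_limit u R T \<longleftrightarrow> (\<forall>c b p. converges_within R c \<longrightarrow> smooth b \<longrightarrow>
     (\<lambda>N. T (\<lambda>p. powser (trunc N c) (u p) * b p) p) \<longlonglongrightarrow> T (\<lambda>p. powser c (u p) * b p) p)"

text \<open>By \<open>D_powser_mult\<close> and additivity of \<open>T\<close>, the claim splits
  into two instances of the hypothesis on \<open>T\<close>: coefficients \<open>diffs c\<close> with
  factor \<open>D u * b\<close>, and \<open>c\<close> with factor \<open>D b\<close>.\<close>

lemma (in partial_derivation) trunc_limit_step:
  assumes u: "smooth u" "\<And>p. \<bar>u p\<bar> < R"
    and T: "trunc_limit u R T"
    and add: "\<And>f g. smooth f \<Longrightarrow> smooth g \<Longrightarrow> T (\<lambda>p. f p + g p) = (\<lambda>p. T f p + T g p)"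
  shows "trunc_limit u R (\<lambda>f. T (D f))"
  unfolding trunc_limit_def
proof (intro allI impI)
  fix c b p
  assume c: "converges_within R c" and b: "smooth b"
  have split: "T (D (\<lambda>p. powser a (u p) * b p)) p =
      T (\<lambda>p. powser (diffs a) (u p) * (D u p * b p)) p + T (\<lambda>p. powser a (u p) * D b p) p"
    if "converges_within R a" for a
    by (subst D_powser_mult[OF u that b], subst add)
      (intro smooth_mult smooth_powser[OF u] that converges_within_diffs smooth_D b u | rule refl)+
  \<comment> \<open>Truncating \<open>c\<close> at \<open>Suc N\<close> gives \<open>diffs c\<close>
    truncated at \<open>N\<close>; \<open>LIMSEQ_imp_Suc\<close> undoes the shift at the
    end.\<close>
  have "(\<lambda>N. T (\<lambda>p. powser (trunc N (diffs c)) (u p) * (D u p * b p)) p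
      + T (\<lambda>p. powser (trunc (Suc N) c) (u p) * D b p) p)
    \<longlonglongrightarrow> T (\<lambda>p. powser (diffs c) (u p) * (D u p * b p)) p + T (\<lambda>p. powser c (u p) * D b p) p"
  proof (intro tendsto_add)
    show "(\<lambda>N. T (\<lambda>p. powser (trunc N (diffs c)) (u p) * (D u p * b p)) p)
        \<longlonglongrightarrow> T (\<lambda>p. powser (diffs c) (u p) * (D u p * b p)) p"
      using T converges_within_diffs[OF c] smooth_mult[OF smooth_D[OF u(1)] b]
      unfolding trunc_limit_def by blast
    have "(\<lambda>N. T (\<lambda>p. powser (trunc N c) (u p) * D b p) p) \<longlonglongrightarrow> T (\<lambda>p. powser c (u p) * D b p) p"
      using T c smooth_D[OF b] unfolding trunc_limit_def by blast
    then show "(\<lambda>N. T (\<lambda>p. powser (trunc (Suc N) c) (u p) * D b p) p)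
        \<longlonglongrightarrow> T (\<lambda>p. powser c (u p) * D b p) p"
      by (rule LIMSEQ_Suc)
  qed
  then have "(\<lambda>N. T (D (\<lambda>p. powser (trunc (Suc N) c) (u p) * b p)) p)
      \<longlonglongrightarrow> T (D (\<lambda>p. powser c (u p) * b p)) p"
    by (simp add: split converges_within_trunc c diffs_trunc)
  then show "(\<lambda>N. T (D (\<lambda>p. powser (trunc N c) (u p) * b p)) p)
      \<longlonglongrightarrow> T (D (\<lambda>p. powser c (u p) * b p)) p"
    by (rule LIMSEQ_imp_Suc)
qed

text \<open>Starting from pointwise convergence of the truncations, the \<open>x\<close>-derivatives
  are added first and then the \<open>v\<close>-derivatives, each new one innermost.\<close>

lemma trunc_limit_mixed:
  assumes u: "smooth u" "\<And>p. \<bar>u p\<bar> < R"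
  shows "trunc_limit u R (\<lambda>f. (dx ^^ k) ((dv ^^ l) f))"
proof (induction l)
  case 0
  have "trunc_limit u R (\<lambda>f. (dx ^^ k) f)"
  proof (induction k)
    case 0
    show ?case
      unfolding trunc_limit_def using u(2)
      by (auto intro!: tendsto_mult_right powser_trunc_tendsto)
  next
    case (Suc k)
    then show ?case
      \<comment> \<open>\<open>funpow_Suc_right\<close> puts the new derivative innermost, as the
        step lemma requires.\<close>
      using dx.trunc_limit_step[OF u Suc] by (simp add: funpow_Suc_right dx.D_funpow_add del: funpow.simps)
  qed
  then show ?case by simp
next
  case (Suc l)
  then show ?case
    using dv.trunc_limit_step[OF u Suc] by (simp add: funpow_Suc_right mixed_add del: funpow.simps)
qed

lemma mixed_powser_trunc_tendsto:
  assumes "smooth u" "\<And>p. \<bar>u p\<bar> < R" "converges_within R c"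
  shows "(\<lambda>N. (dx ^^ k) ((dv ^^ l) (\<lambda>p. powser (trunc N c) (u p))) p)
    \<longlonglongrightarrow> (dx ^^ k) ((dv ^^ l) (\<lambda>p. powser c (u p))) p"
  \<comment> \<open>The auxiliary factor \<open>b\<close> is taken to be the constant 1.\<close>
  using trunc_limit_mixed[OF assms(1,2), of k l] assms(3) smooth_const[of 1]
  unfolding trunc_limit_def by fastforce

section \<open>The majorant and the Lipschitz estimate\<close>

lemma summable_majorant_deriv:
  assumes "converges_within R c" "0 \<le> r" "r < R"
  shows "summable (\<lambda>n. real (Suc n) * \<bar>c (Suc n)\<bar> * r ^ n)"
proof -
  \<comment> \<open>Convergence at an intermediate \<open>s\<close> gives absolute convergence for
    smaller arguments; the gap between \<open>r\<close> and \<open>s\<close> then pays for the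
    factor \<open>Suc n\<close> from differentiation.\<close>
  obtain s where s: "r < s" "s < R" using assms(3) dense by blast
  then have "summable (\<lambda>n. c n * s ^ n)"
    using assms unfolding converges_within_def by auto
  then have "summable (\<lambda>n. \<bar>c n\<bar> * z ^ n)" if "norm z < s" for z
    using powser_insidea[of c s "\<bar>z\<bar>"] that
    by (intro summable_norm_cancel[of "\<lambda>n. \<bar>c n\<bar> * z ^ n"]) (auto simp: abs_mult power_abs)
  then have "summable (\<lambda>n. diffs (\<lambda>n. \<bar>c n\<bar>) n * r ^ n)"
    using s assms by (intro termdiff_converges[of r s]) auto
  then show ?thesis by (simp add: diffs_def)
qed

text \<open>The estimate for polynomials, with a constant independent of \<open>N\<close> so that it
  survives the limit.\<close>

lemma lam_norm_trunc_diff: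
  assumes "smooth u" "smooth w" "lam \<ge> 0" "converges_within R c" "0 \<le> r" "r < R"
    and "lam_norm lam u \<le> ennreal r" "lam_norm lam w \<le> ennreal r"
  shows "lam_norm lam (\<lambda>p. powser (trunc N c) (u p) - powser (trunc N c) (w p))
    \<le> ennreal (majorant_deriv c r) * lam_norm lam (\<lambda>p. u p - w p)"
proof -
  let ?d = "lam_norm lam (\<lambda>p. u p - w p)"
  let ?m = "\<lambda>n. real n * \<bar>c n\<bar> * r ^ (n - 1)"
  have "lam_norm lam (\<lambda>p. powser (trunc N c) (u p) - powser (trunc N c) (w p)) =
      lam_norm lam (\<lambda>p. \<Sum>n<N. c n * (u p ^ n - w p ^ n))"
    by (simp add: powser_trunc sum_subtractf right_diff_distrib)
  also have "\<dots> \<le> (\<Sum>n<N. lam_norm lam (\<lambda>p. c n * (u p ^ n - w p ^ n)))"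
    by (intro lam_norm_sum smooth_mult smooth_const smooth_diff smooth_power assms)
  also have "\<dots> \<le> (\<Sum>n<N. ennreal (?m n) * ?d)"
  proof (rule sum_mono)
    fix n
    have "lam_norm lam (\<lambda>p. u p ^ n - w p ^ n) \<le> of_nat n * ennreal r ^ (n - 1) * ?d"
      using lam_norm_power_diff[OF assms(1-3,7,8), of "n - 1"]
      \<comment> \<open>For \<open>n = 0\<close> the difference is the zero function, and the factor
        \<open>of_nat n\<close> makes the bound zero too.\<close>
      by (cases n) (simp_all add: lam_norm_const)
    then have "ennreal \<bar>c n\<bar> * lam_norm lam (\<lambda>p. u p ^ n - w p ^ n)
        \<le> ennreal \<bar>c n\<bar> * (of_nat n * ennreal r ^ (n - 1) * ?d)"
      by (rule mult_left_mono) simp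
    also have "\<dots> = ennreal (?m n) * ?d"
      using assms(5) by (simp add: ennreal_mult ennreal_power ennreal_of_nat_eq_real_of_nat mult_ac)
    finally show "lam_norm lam (\<lambda>p. c n * (u p ^ n - w p ^ n)) \<le> ennreal (?m n) * ?d"
      by (intro order.trans[OF lam_norm_cmult] smooth_diff smooth_power assms)
  qed
  also have "\<dots> = ennreal (\<Sum>n<N. ?m n) * ?d"
    using assms(5) by (simp add: sum_distrib_right[symmetric] sum_ennreal)
  also have "\<dots> \<le> ennreal (majorant_deriv c r) * ?d"
  proof (intro mult_right_mono ennreal_leI)
    \<comment> \<open>One term is added so that, once the vanishing term \<open>n = 0\<close> is
      split off, exactly \<open>N\<close> terms of the shifted series remain.\<close>
    have "(\<Sum>n<N. ?m n) \<le> (\<Sum>n<Suc N. ?m n)"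
      using assms(5) by simp
    also have "\<dots> = (\<Sum>n<N. real (Suc n) * \<bar>c (Suc n)\<bar> * r ^ n)"
      by (subst sum.lessThan_Suc_shift) simp
    also have "\<dots> \<le> majorant_deriv c r"
      unfolding majorant_deriv_def using assms(5)
      by (intro sum_le_suminf summable_majorant_deriv[OF assms(4-6)]) auto
    finally show "(\<Sum>n<N. ?m n) \<le> majorant_deriv c r" .
  qed simp
  finally show ?thesis .
qed

theorem lemma3p7:
  fixes \<Phi> :: "real \<Rightarrow> real" and c :: "nat \<Rightarrow> real" and R \<Lambda> lam :: real
    and u w :: "real \<times> real \<Rightarrow> real" and R\<^sub>0 :: ennreal
  assumes "R > 0"
    and "power_expansion \<Phi> c R"
    and "analytic_radius \<Lambda> u"
    and "analytic_radius \<Lambda> w"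
    and "0 < lam" and "lam < \<Lambda>"
    and "R\<^sub>0 = max (lam_norm lam u) (lam_norm lam w)"
    and "R\<^sub>0 < ennreal R"
  shows "smooth (\<lambda>p. \<Phi> (u p) - \<Phi> (w p)) \<and>
    lam_norm lam (\<lambda>p. \<Phi> (u p) - \<Phi> (w p))
      \<le> ennreal (majorant_deriv c (enn2real R\<^sub>0)) * lam_norm lam (\<lambda>p. u p - w p)"
proof -
  define r where "r = enn2real R\<^sub>0"
  \<comment> \<open>Finiteness of \<open>R\<^sub>0\<close> ensures that \<open>enn2real\<close>
    loses no information.\<close>
  have "R\<^sub>0 < top"
    by (rule order.strict_trans[OF assms(8)]) simp
  then have R0: "R\<^sub>0 = ennreal r"
    by (simp add: r_def)
  have "0 \<le> r"
    by (simp add: r_def)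
  moreover have "ennreal r < ennreal R"
    using assms(8) by (simp only: R0)
  ultimately have r: "0 \<le> r" "r < R"
    by (simp_all add: ennreal_less_iff)
  have sm: "smooth u" "smooth w"
    using assms(3,4) by (auto simp: analytic_radius_def)
  have norm_le: "lam_norm lam u \<le> ennreal r" "lam_norm lam w \<le> ennreal r"
    unfolding R0[symmetric] assms(7) by auto
  have bound: "\<bar>f p\<bar> < R" if "lam_norm lam f \<le> ennreal r" for f p
  proof -
    have "ennreal \<bar>f p\<bar> \<le> ennreal r"
      using supnorm_upper supnorm_le_lam_norm that by (meson order.trans)
    then show ?thesis using r by simp
  qed
  note u = bound[OF norm_le(1)] and w = bound[OF norm_le(2)]
  have conv: "converges_within R c"
    using assms(2) unfolding power_expansion_def converges_within_def by (auto intro: sums_summable)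
  \<comment> \<open>Outside the interval \<Phi> is arbitrary, but \<open>u\<close> and
    \<open>w\<close> never leave it, so both compositions can be rewritten with
    \<open>powser c\<close>.\<close>
  have "\<Phi> z = powser c z" if "\<bar>z\<bar> < R" for z
    using assms(2) that unfolding power_expansion_def powser_def by (auto simp: sums_iff)
  then have eq: "(\<lambda>p. \<Phi> (u p) - \<Phi> (w p)) = (\<lambda>p. powser c (u p) - powser c (w p))"
    using u w by simp
  have "smooth (\<lambda>p. powser c (u p) - powser c (w p))"
    by (intro smooth_diff smooth_powser[OF sm(1) u conv] smooth_powser[OF sm(2) w conv])
  moreover have "lam_norm lam (\<lambda>p. powser c (u p) - powser c (w p))
      \<le> ennreal (majorant_deriv c r) * lam_norm lam (\<lambda>p. u p - w p)"
  proof (rule lam_norm_limit_le)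
    show "lam_norm lam (\<lambda>p. powser (trunc N c) (u p) - powser (trunc N c) (w p))
      \<le> ennreal (majorant_deriv c r) * lam_norm lam (\<lambda>p. u p - w p)" for N
      using sm assms(5) conv r norm_le by (intro lam_norm_trunc_diff) auto
    show "(\<lambda>N. (dx ^^ k) ((dv ^^ l) (\<lambda>p. powser (trunc N c) (u p) - powser (trunc N c) (w p))) p)
      \<longlonglongrightarrow> (dx ^^ k) ((dv ^^ l) (\<lambda>p. powser c (u p) - powser c (w p))) p" for k l p
      using sm u w conv
      by (simp add: mixed_diff smooth_powser[of _ R] converges_within_trunc)
        (intro tendsto_diff mixed_powser_trunc_tendsto; assumption)
  qed
  ultimately show ?thesis by (simp add: eq r_def)
qed

end
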